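(* Let $\sigma>1$. Then there exists a constant $C_\sigma>0$ such that $$\|\mu_\sigma^{*n}\|_\infty:=\sup_{x\in\Lambda_n}\mu_\sigma^{*n}(x)\le\frac{C_\sigma}{\sqrt{n}}\qquad\text{for all } n\in\mathbb{N}.$$
   Context: Here $\mathbb{N}=\{1,2,\dots\}$ and $\zeta(s)=\sum_{m=1}^\infty m^{-s}$ for $\mathrm{Re}\,s>1$ is the Riemann zeta function. For $\sigma>1$, the Riemann zeta distribution $\mu_\sigma$ is the probability distribution on $\mathbb{R}$ with $\mu_\sigma(\{-\log m\})=m^{-\sigma}/\zeta(\sigma)$ for $m\in\mathbb{N}$; it is identified with its mass function $\mu_\sigma(x)$. Its $n$-th convolution power, viewed as a mass function, is $$\mu_\sigma^{*n}(x)=\sum_{m_1,\dots,m_n=1}^\infty\frac{(m_1\cdots m_n)^{-\sigma}}{\zeta(\sigma)^n}\mathbf{1}_{\{-\log(m_1\cdots m_n)\}}(x),$$ with support $\Lambda_n=\{-\log(m_1\cdots m_n): m_1,\dots,m_n\in\mathbb{N}\}$. *)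

theory Defs
  imports "HOL-Probability.Probability"
begin

(* Polymorphic so that it covers real as well as complex arguments; only meant for Re s > 1,
   where the series converges absolutely. *)
definition zeta :: "'a::{ln, banach, real_normed_field} \<Rightarrow> 'a" where
  "zeta s = (\<Sum>k. of_nat (Suc k) powr (- s))"

(* The mass function of a measure M on the reals is x |-> measure M {x}; for the convolution
   powers it is made explicit in measure_conv_power_riemann_zeta_distr below. *)
definition riemann_zeta_distr :: "real \<Rightarrow> real measure" where
  "riemann_zeta_distr \<sigma> =
     distr (point_measure {1::nat..} (\<lambda>m. ennreal (real m powr (- \<sigma>) / zeta \<sigma>)))
           borel (\<lambda>m. - ln (real m))"

primrec conv_power :: "real measure \<Rightarrow> nat \<Rightarrow> real measure" where
  "conv_power M 0 = return borel 0"
| "conv_power M (Suc n) = (M \<star> conv_power M n)"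

definition pos_tuples :: "nat \<Rightarrow> nat list set" where
  "pos_tuples n = {ms. length ms = n \<and> (\<forall>m\<in>set ms. m \<ge> 1)}"

definition Lambda :: "nat \<Rightarrow> real set" where
  "Lambda n = {- ln (real (prod_list ms)) | ms. ms \<in> pos_tuples n}"

lemma zeta_sums:
  fixes \<sigma> :: real
  assumes "\<sigma> > 1"
  shows "(\<lambda>k. real (Suc k) powr (- \<sigma>)) sums zeta \<sigma>"
proof -
  have "summable (\<lambda>k. real k powr (- \<sigma>))"
    using assms by (subst summable_real_powr_iff) auto
  then have "summable (\<lambda>k. real (Suc k) powr (- \<sigma>))"
    by (subst summable_Suc_iff)
  then show ?thesis
    unfolding zeta_def by (simp add: summable_sums)
qed

lemma zeta_pos:
  fixes \<sigma> :: real
  assumes "\<sigma> > 1"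
  shows "zeta \<sigma> > 0"
  using suminf_pos[OF sums_summable[OF zeta_sums[OF assms]]] sums_unique[OF zeta_sums[OF assms]]
  by simp

lemma zeta_of_real:
  fixes \<sigma> :: real
  assumes "\<sigma> > 1"
  shows "zeta (complex_of_real \<sigma>) = of_real (zeta \<sigma>)"
proof -
  have "(\<lambda>k. of_real (real (Suc k) powr (- \<sigma>)) :: complex) sums of_real (zeta \<sigma>)"
    using zeta_sums[OF assms] by (subst sums_of_real_iff)
  also have "(\<lambda>k. of_real (real (Suc k) powr (- \<sigma>)) :: complex) =
      (\<lambda>k. of_nat (Suc k) powr (- complex_of_real \<sigma>))"
    by (rule ext, subst powr_of_real[symmetric]) simp_all
  finally show ?thesis
    unfolding zeta_def[of "complex_of_real \<sigma>"] using sums_unique by metis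
qed

lemma sets_riemann_zeta_distr [simp, measurable_cong]:
    "sets (riemann_zeta_distr \<sigma>) = sets borel"
  and space_riemann_zeta_distr [simp]: "space (riemann_zeta_distr \<sigma>) = UNIV"
  by (simp_all add: riemann_zeta_distr_def)

lemma sets_conv_power [simp, measurable_cong]: "sets (conv_power M n) = sets borel"
  and space_conv_power [simp]: "space (conv_power M n) = UNIV"
  by (cases n; simp)+

lemma riemann_zeta_distr_pmf:
  assumes "\<sigma> > 1"
  obtains p :: "nat pmf"
  where "\<And>m. pmf p m = real m powr (- \<sigma>) / zeta \<sigma>"
    and "riemann_zeta_distr \<sigma> = distr (measure_pmf p) borel (\<lambda>m. - ln (real m))"
proof -
  define f where "f m = real m powr (- \<sigma>) / zeta \<sigma>" for m :: nat
  have nn: "f m \<ge> 0" for m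
    using zeta_pos[OF assms] by (simp add: f_def)
  have "(\<lambda>k. f (Suc k)) sums (zeta \<sigma> / zeta \<sigma>)"
    unfolding f_def by (intro sums_divide zeta_sums assms)
  then have "f sums 1"
    using zeta_pos[OF assms] by (subst (asm) sums_Suc_iff) (simp add: f_def)
  then have one: "(\<integral>\<^sup>+m. ennreal (f m) \<partial>count_space UNIV) = 1"
    using nn by (simp add: nn_integral_count_space_nat suminf_ennreal2 sums_summable
        sums_unique[symmetric])
  define p where "p = embed_pmf f"
  have p: "pmf p m = f m" for m
    unfolding p_def by (rule pmf_embed_pmf[OF nn one])
  have "riemann_zeta_distr \<sigma> = distr (measure_pmf p) borel (\<lambda>m. - ln (real m))"
  proof (rule measure_eqI)
    fix A assume "A \<in> sets (riemann_zeta_distr \<sigma>)"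
    then have A: "A \<in> sets borel" by simp
    let ?B = "(\<lambda>m::nat. - ln (real m)) -` A"
    have "emeasure (riemann_zeta_distr \<sigma>) A = emeasure (point_measure {1..} f) (?B \<inter> {1..})"
      unfolding riemann_zeta_distr_def f_def
      by (subst emeasure_distr)
         (auto simp: A space_point_measure measurable_def sets_point_measure)
    also have "\<dots> = (\<integral>\<^sup>+m. ennreal (f m) * indicator (?B \<inter> {1..}) m \<partial>count_space {1..})"
      unfolding point_measure_def by (subst emeasure_density) auto
    also have "\<dots> = (\<integral>\<^sup>+m. ennreal (f m) * indicator ?B m \<partial>count_space UNIV)"
      by (subst nn_integral_count_space_indicator)
         (auto intro!: nn_integral_cong simp: indicator_def f_def Suc_le_eq)
    also have "\<dots> = emeasure (measure_pmf p) ?B"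
      by (simp add: measure_pmf_eq_density[of p] p emeasure_density)
    also have "\<dots> = emeasure (distr (measure_pmf p) borel (\<lambda>m. - ln (real m))) A"
      by (subst emeasure_distr) (auto simp: A)
    finally show "emeasure (riemann_zeta_distr \<sigma>) A =
        emeasure (distr (measure_pmf p) borel (\<lambda>m. - ln (real m))) A" .
  qed simp
  then show ?thesis
    by (intro that[of p]) (simp_all add: p f_def)
qed

lemma prob_space_riemann_zeta_distr:
  assumes "\<sigma> > 1"
  shows "prob_space (riemann_zeta_distr \<sigma>)"
  using riemann_zeta_distr_pmf[OF assms]
  by (metis measurable_measure_pmf measurable_pmf_measure1 UNIV_I Pi_I' space_borel
      measure_pmf.prob_space_distr)

lemma measure_riemann_zeta_distr:
  assumes "\<sigma> > 1" "m \<ge> 1"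
  shows "measure (riemann_zeta_distr \<sigma>) {- ln (real m)} = real m powr (- \<sigma>) / zeta \<sigma>"
proof -
  obtain p :: "nat pmf" where p: "\<And>m. pmf p m = real m powr (- \<sigma>) / zeta \<sigma>"
    "riemann_zeta_distr \<sigma> = distr (measure_pmf p) borel (\<lambda>m. - ln (real m))"
    using riemann_zeta_distr_pmf[OF assms(1)] by blast
  have "measure (riemann_zeta_distr \<sigma>) {- ln (real m)} =
      measure (measure_pmf p) ((\<lambda>m. - ln (real m)) -` {- ln (real m)})"
    unfolding p(2) by (subst measure_distr) auto
  also have "\<dots> = measure (measure_pmf p) {m}"
  proof (rule measure_pmf.finite_measure_eq_AE)
    show "AE k in measure_pmf p. k \<in> (\<lambda>m. - ln (real m)) -` {- ln (real m)} \<longleftrightarrow> k \<in> {m}"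
    proof (rule AE_pmfI)
      fix k assume "k \<in> set_pmf p"
      then have "k > 0"
        using p(1)[of k] by (cases k) (auto simp: set_pmf_iff)
      then show "k \<in> (\<lambda>m. - ln (real m)) -` {- ln (real m)} \<longleftrightarrow> k \<in> {m}"
        using assms(2) by simp
    qed
  qed auto
  finally show ?thesis
    by (simp add: measure_pmf_single p(1))
qed

lemma conv_power_pmf:
  fixes p :: "nat pmf"
  assumes "pmf p 0 = 0"
  defines "M \<equiv> distr (measure_pmf p) borel (\<lambda>m. - ln (real m))"
  shows "conv_power M n =
     distr (measure_pmf (replicate_pmf n p)) borel (\<lambda>ms. - ln (real (prod_list ms)))"
proof (induction n)
  case 0
  show ?case
    by (rule measure_eqI) (auto simp: emeasure_distr indicator_def)
next
  case (Suc n)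
  let ?g = "\<lambda>ms. - ln (real (prod_list ms))"
  let ?R = "distr (measure_pmf (replicate_pmf n p)) borel ?g"
  have fin: "finite_measure M" "finite_measure ?R"
    unfolding M_def
    by (intro prob_space.finite_measure measure_pmf.prob_space_distr; simp)+
  have pos: "m \<ge> 1" if "m \<in> set_pmf p" for m
    using that assms(1) by (cases m) (auto simp: set_pmf_iff)
  show ?case
  proof (rule measure_eqI)
    fix A assume "A \<in> sets (conv_power M (Suc n))"
    then have A: "A \<in> sets borel" by simp
    have [measurable]: "(\<lambda>x. emeasure ?R {a. a + x \<in> A}) \<in> borel_measurable borel"
    proof -
      interpret R: finite_measure ?R by (rule fin)
      have "{z. snd z + fst z \<in> A} \<in> sets (borel \<Otimes>\<^sub>M ?R)"
      proof -
        have "(\<lambda>z::real \<times> real. snd z + fst z) -` A \<inter> space (borel \<Otimes>\<^sub>M ?R) \<in> sets (borel \<Otimes>\<^sub>M ?R)"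
          by (rule measurable_sets[OF _ A]) measurable
        then show ?thesis by (simp add: vimage_def space_pair_measure)
      qed
      from R.measurable_emeasure_Pair[OF this] show ?thesis
        by (simp add: vimage_def)
    qed
    have "emeasure (conv_power M (Suc n)) A = (\<integral>\<^sup>+x. emeasure ?R {a. a + x \<in> A} \<partial>M)"
      unfolding conv_power.simps Suc
      by (rule convolution_emeasure) (use A fin in \<open>auto simp: M_def\<close>)
    also have "\<dots> = (\<integral>\<^sup>+m. emeasure ?R {a. a + - ln (real m) \<in> A} \<partial>measure_pmf p)"
      unfolding M_def by (subst nn_integral_distr) auto
    also have "\<dots> = (\<integral>\<^sup>+m. emeasure (measure_pmf (replicate_pmf n p)) {ms. ?g (m # ms) \<in> A} \<partial>measure_pmf p)"
    proof (intro nn_integral_cong_AE AE_pmfI)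
      fix m assume m: "m \<in> set_pmf p"
      have "(\<lambda>a::real. a + - ln (real m)) -` A \<inter> space borel \<in> sets borel"
        by (rule measurable_sets[OF _ A]) measurable
      then have "{a. a + - ln (real m) \<in> A} \<in> sets borel" by (simp add: vimage_def)
      then have "emeasure ?R {a. a + - ln (real m) \<in> A} =
          emeasure (measure_pmf (replicate_pmf n p)) {ms. ?g ms + - ln (real m) \<in> A}"
        by (subst emeasure_distr) (auto simp: vimage_def)
      also have "\<dots> = emeasure (measure_pmf (replicate_pmf n p)) {ms. ?g (m # ms) \<in> A}"
      proof (intro emeasure_eq_AE AE_pmfI)
        fix ms assume "ms \<in> set_pmf (replicate_pmf n p)"
        then have "\<forall>k\<in>set ms. k \<ge> 1" using pos by (auto simp: set_replicate_pmf lists_eq_set)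
        then have "prod_list ms > 0" by (induction ms) auto
        then have "?g ms + - ln (real m) = ?g (m # ms)"
          using pos[OF m] by (simp add: ln_mult)
        then show "ms \<in> {ms. ?g ms + - ln (real m) \<in> A} \<longleftrightarrow> ms \<in> {ms. ?g (m # ms) \<in> A}"
          by simp
      qed auto
      finally show "emeasure ?R {a. a + - ln (real m) \<in> A} =
          emeasure (measure_pmf (replicate_pmf n p)) {ms. ?g (m # ms) \<in> A}" .
    qed
    also have "\<dots> = emeasure (measure_pmf (replicate_pmf (Suc n) p)) {ms. ?g ms \<in> A}"
      by (simp add: map_pmf_def[symmetric] vimage_def)
    also have "\<dots> = emeasure (distr (measure_pmf (replicate_pmf (Suc n) p)) borel ?g) A"
      by (subst emeasure_distr) (auto simp: A vimage_def)
    finally show "emeasure (conv_power M (Suc n)) A =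
        emeasure (distr (measure_pmf (replicate_pmf (Suc n) p)) borel ?g) A" .
  qed simp
qed

lemma pmf_replicate_pmf:
  "pmf (replicate_pmf n p) xs = (if length xs = n then prod_list (map (pmf p) xs) else 0)"
proof (induction n arbitrary: xs)
  case 0
  show ?case by (auto simp: indicator_def)
next
  case (Suc n)
  have eq: "replicate_pmf (Suc n) p = map_pmf (\<lambda>(x, xs). x # xs) (pair_pmf p (replicate_pmf n p))"
    by (simp add: pair_pmf_def map_bind_pmf)
  show ?case
  proof (cases xs)
    case Nil
    then have "xs \<notin> set_pmf (replicate_pmf (Suc n) p)"
      by (subst set_replicate_pmf) auto
    then show ?thesis using Nil by (simp add: set_pmf_iff del: replicate_pmf.simps)
  next
    case (Cons y ys)
    have "pmf (replicate_pmf (Suc n) p) ((\<lambda>(x, xs). x # xs) (y, ys)) =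
        pmf (pair_pmf p (replicate_pmf n p)) (y, ys)"
      unfolding eq by (rule pmf_map_inj') (auto simp: inj_def)
    then show ?thesis
      using Cons Suc[of ys] by (simp add: pmf_pair)
  qed
qed

theorem measure_conv_power_riemann_zeta_distr:
  assumes "\<sigma> > 1"
  shows "measure (conv_power (riemann_zeta_distr \<sigma>) n) {x} =
    (\<Sum>\<^sub>\<infinity>ms\<in>pos_tuples n. real (prod_list ms) powr (- \<sigma>) / zeta \<sigma> ^ n
       * indicator {- ln (real (prod_list ms))} x)"
proof -
  obtain p :: "nat pmf" where p: "\<And>m. pmf p m = real m powr (- \<sigma>) / zeta \<sigma>"
    "riemann_zeta_distr \<sigma> = distr (measure_pmf p) borel (\<lambda>m. - ln (real m))"
    using riemann_zeta_distr_pmf[OF assms] by blast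
  have p0: "pmf p 0 = 0" by (simp add: p(1))
  let ?P = "replicate_pmf n p"
  let ?A = "{ms. - ln (real (prod_list ms)) = x}"
  have pr: "prod_list (map (pmf p) ms) = real (prod_list ms) powr (- \<sigma>) / zeta \<sigma> ^ length ms" for ms
    by (induction ms) (auto simp: p(1) powr_mult)
  have "measure (conv_power (riemann_zeta_distr \<sigma>) n) {x} = measure (measure_pmf ?P) ?A"
    unfolding p(2) conv_power_pmf[OF p0]
    by (subst measure_distr) (auto simp: vimage_def)
  also have "\<dots> = infsetsum (pmf ?P) ?A"
    by (simp add: measure_pmf_conv_infsetsum)
  also have "\<dots> = infsum (pmf ?P) ?A"
    by (rule infsetsum_infsum) (rule pmf_abs_summable)
  also have "\<dots> = (\<Sum>\<^sub>\<infinity>ms\<in>pos_tuples n. real (prod_list ms) powr (- \<sigma>) / zeta \<sigma> ^ n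
       * indicator {- ln (real (prod_list ms))} x)"
  proof (rule infsum_cong_neutral)
    fix ms assume "ms \<in> ?A - pos_tuples n"
    then have "ms \<notin> set_pmf ?P"
      using p0 by (force simp: set_replicate_pmf pos_tuples_def set_pmf_iff not_le)
    then show "pmf ?P ms = 0" by (simp add: set_pmf_iff)
  next
    fix ms assume "ms \<in> ?A \<inter> pos_tuples n"
    then show "pmf ?P ms = real (prod_list ms) powr (- \<sigma>) / zeta \<sigma> ^ n
       * indicator {- ln (real (prod_list ms))} x"
      by (auto simp: pmf_replicate_pmf pr pos_tuples_def)
  qed (auto simp: indicator_def)
  finally show ?thesis .
qed

end

(* The bound holds for every probability measure on the reals with two distinct atoms a and b; for
   the zeta distribution take 0 and - ln 2. Let d be the smaller of their masses and let A be
   convolution with the uniform distribution on {a, b}. Then M = 2 d A + (1 - 2 d) B for some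
   contraction B commuting with A, so the sup norm of A^k M^n is at most
   2 d |A^(k+1) M^(n-1)| + (1 - 2 d) |A^k M^(n-1)|. Since A^k has atoms at most binomial(k, k/2) / 2^k <= 1 / sqrt (k + 1), induction on n gives
   A^k M^n <= 1 / sqrt (k + 1 + n d / 2): the induction step is a convexity estimate for
   s |-> 1 / sqrt s. *)
theory Submission
  imports Defs
begin

section \<open>Bounds for binomial probabilities\<close>

text \<open>In squared form the induction stays free of roots. By the ratio of consecutive central
  coefficients, the step reduces to (2 m + 1) (2 m + 3) \<le> 4 (m + 1)^2.\<close>

lemma central_binomial_upper_bound:
  "(real ((2 * m) choose m))\<^sup>2 * (2 * real m + 1) \<le> 16 ^ m"
proof (induction m)
  case 0
  show ?case by simp
next
  case (Suc m)
  let ?c = "real ((2 * m) choose m)" and ?d = "real ((2 * Suc m) choose Suc m)"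
  have "Suc m * ((2 * Suc m) choose Suc m) = 2 * (2 * m + 1) * ((2 * m) choose m)"
  proof -
    have eq: "2 * Suc m = Suc (2 * m + 1)" by simp
    have "Suc m * ((2 * Suc m) choose Suc m) = (2 * Suc m) * ((2 * m + 1) choose m)"
      unfolding eq Suc_times_binomial_eq by (rule mult.commute)
    then have "Suc m * ((2 * Suc m) choose Suc m) = Suc m * (2 * ((2 * m + 1) choose m))"
      by (simp only: mult_ac)
    then have "(2 * Suc m) choose Suc m = 2 * ((2 * m + 1) choose m)"
      by (simp only: mult_cancel1) simp
    moreover have "Suc m * ((2 * m + 1) choose m) = (2 * m + 1) * ((2 * m) choose m)"
      using Suc_times_binomial_eq[of "2 * m" m] binomial_symmetric[of m "2 * m + 1"] by simp
    ultimately show ?thesis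
      by (simp only: mult.left_commute[of "Suc m" 2] mult.assoc)
  qed
  then have "real (Suc m * ((2 * Suc m) choose Suc m)) = real (2 * (2 * m + 1) * ((2 * m) choose m))"
    by (simp only:)
  then have rec: "(real m + 1) * ?d = 2 * (2 * real m + 1) * ?c"
    by (simp only: of_nat_mult of_nat_Suc of_nat_add of_nat_numeral of_nat_1) (simp add: algebra_simps)
  have "(real m + 1)\<^sup>2 * (?d\<^sup>2 * (2 * real (Suc m) + 1))
      = ((real m + 1) * ?d)\<^sup>2 * (2 * real m + 3)"
  proof -
    have "2 * real (Suc m) + 1 = 2 * real m + 3" by simp
    then show ?thesis by (simp only: power_mult_distrib mult.assoc)
  qed
  also have "\<dots> = 4 * ((2 * real m + 1) * (2 * real m + 3)) * (?c\<^sup>2 * (2 * real m + 1))"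
    unfolding rec by (simp add: power2_eq_square algebra_simps)
  also have "\<dots> \<le> (16 * (real m + 1)\<^sup>2) * 16 ^ m"
    by (rule mult_mono[OF _ Suc.IH]) (auto simp: power2_eq_square algebra_simps)
  finally have "(real m + 1)\<^sup>2 * (?d\<^sup>2 * (2 * real (Suc m) + 1)) \<le> (real m + 1)\<^sup>2 * 16 ^ Suc m"
    by (simp add: mult_ac)
  then show ?case
    by (rule mult_left_le_imp_le) simp
qed

lemma binomial_pow2_upper_bound:
  "real (k choose j) / 2 ^ k \<le> 1 / sqrt (real k + 1)"
proof -
  have sixteen: "((2 :: real) ^ (2 * m))\<^sup>2 = 16 ^ m" for m
    by (simp add: power_mult power2_eq_square power_mult_distrib[symmetric])
  have even_case: "real ((2 * m) choose j) / 2 ^ (2 * m) \<le> 1 / sqrt (2 * real m + 1)" for m j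
  proof -
    have "real ((2 * m) choose j) \<le> real ((2 * m) choose m)"
      using binomial_maximum'[of m j] by simp
    moreover have "real ((2 * m) choose m) * sqrt (2 * real m + 1) \<le> 2 ^ (2 * m)"
    proof (rule power2_le_imp_le)
      show "(real ((2 * m) choose m) * sqrt (2 * real m + 1))\<^sup>2 \<le> (2 ^ (2 * m))\<^sup>2"
        using central_binomial_upper_bound[of m]
        by (simp add: power_mult_distrib sixteen)
    qed simp
    ultimately have "real ((2 * m) choose j) * sqrt (2 * real m + 1) \<le> 2 ^ (2 * m)"
      by (meson mult_right_mono order_trans real_sqrt_ge_zero of_nat_0_le_iff add_nonneg_nonneg
          mult_nonneg_nonneg zero_le_numeral zero_le_one)
    then show ?thesis by (simp add: field_simps)
  qed
  show ?thesis
  proof (cases "even k")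
    case True
    then obtain m where "k = 2 * m" by (elim evenE)
    with even_case[of m j] show ?thesis by simp
  next
    case False
    then obtain m where k: "k = 2 * m + 1" by (elim oddE)
    \<comment> \<open>The two middle coefficients of the odd row \<open>k\<close> agree, and by
      Pascal's rule they add up to the central coefficient of row \<open>k + 1\<close>. This reduces
      the odd case to the even one.\<close>
    have "2 * (k choose j) \<le> (2 * (m + 1)) choose (m + 1)"
    proof -
      have "k choose j \<le> k choose m"
        using binomial_maximum[of k j] k by simp
      moreover have "k choose m = k choose (Suc m)"
        using binomial_symmetric[of m k] k by simp
      ultimately show ?thesis using k by simp
    qed
    then have "2 * real (k choose j) \<le> real ((2 * (m + 1)) choose (m + 1))"
      by linarith
    then have "real (k choose j) / 2 ^ k \<le> real ((2 * (m + 1)) choose (m + 1)) / 2 ^ (2 * (m + 1))"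
      using k by (simp add: field_simps)
    also have "\<dots> \<le> 1 / sqrt (2 * real (m + 1) + 1)"
      by (rule even_case)
    also have "\<dots> \<le> 1 / sqrt (real k + 1)"
      using k by (intro divide_left_mono) auto
    finally show ?thesis .
  qed
qed

section \<open>A convexity estimate for the inverse square root\<close>

lemma inverse_sqrt_mixture_bound:
  fixes d s :: real
  assumes d: "0 \<le> d" "d \<le> 1" and s: "1 \<le> s"
  shows "d * (1 / sqrt (s + 1)) + (1 - d) * (1 / sqrt s) \<le> 1 / sqrt (s + d / 4)"
proof -
  define u v where "u = 1 / s" and "v = d * u / 4"
  have u: "0 < u" "u \<le> 1" using s by (auto simp: u_def)
  have v: "0 \<le> v" "v \<le> 1"
    using d u mult_mono[of d 1 u 1] by (auto simp: v_def)
  have split1: "sqrt (s + 1) = sqrt s * sqrt (1 + u)" and split2: "sqrt (s + d / 4) = sqrt s * sqrt (1 + v)"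
    using s by (auto simp: u_def v_def real_sqrt_mult[symmetric] field_simps)
  \<comment> \<open>The tangent at 0 has slope -1/2; the weaker slope -1/4 makes the upper bound
    hold up to u = 1. It is the source of the 4 in \<open>d / 4\<close>.\<close>
  have "1 \<le> (1 - u / 4)\<^sup>2 * (1 + u)"
  proof -
    have "(1 - u / 4)\<^sup>2 * (1 + u) - 1 = u * (1 / 2 - 7 / 16 * u + u * u / 16)"
      by (simp add: power2_eq_square field_simps)
    moreover have "0 \<le> 1 / 2 - 7 / 16 * u + u * u / 16"
      using u by (intro add_nonneg_nonneg) auto
    ultimately show ?thesis using u by (smt (verit) mult_nonneg_nonneg)
  qed
  then have "1\<^sup>2 \<le> ((1 - u / 4) * sqrt (1 + u))\<^sup>2"
    using u by (simp add: power_mult_distrib)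
  then have "1 \<le> (1 - u / 4) * sqrt (1 + u)"
    by (rule power2_le_imp_le) (use u in auto)
  then have 1: "1 / sqrt (1 + u) \<le> 1 - u / 4"
    using u by (simp add: field_simps)
  have "(1 - v)\<^sup>2 * (1 + v) = (1 - v) * (1 - v * v)"
    by (simp add: power2_eq_square algebra_simps)
  also have "\<dots> \<le> 1 * 1"
    using v mult_mono[of v 1 v 1] by (intro mult_mono) auto
  finally have "((1 - v) * sqrt (1 + v))\<^sup>2 \<le> 1\<^sup>2"
    using v by (simp add: power_mult_distrib)
  then have "(1 - v) * sqrt (1 + v) \<le> 1"
    by (rule power2_le_imp_le) simp
  then have 2: "1 - v \<le> 1 / sqrt (1 + v)"
    using v by (simp add: field_simps)
  have "d * (1 / sqrt (1 + u)) + (1 - d) \<le> 1 / sqrt (1 + v)"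
    using mult_left_mono[OF 1 d(1)] 2 by (simp add: v_def algebra_simps)
  then have "(d * (1 / sqrt (1 + u)) + (1 - d)) / sqrt s \<le> (1 / sqrt (1 + v)) / sqrt s"
    by (rule divide_right_mono) (use s in auto)
  then show ?thesis
    unfolding split1 split2 by (simp add: add_divide_distrib mult_ac)
qed

section \<open>Convolution and mass functions\<close>

lemma prob_space_convolution:
  fixes M N :: "real measure"
  assumes "prob_space M" "prob_space N" and [measurable_cong]: "sets M = sets borel" "sets N = sets borel"
  shows "prob_space (M \<star> N)"
proof -
  interpret M: prob_space M by fact
  interpret N: prob_space N by fact
  interpret pair_prob_space M N ..
  show ?thesis
    unfolding convolution_def by (rule prob_space_distr) measurable
qed

lemma prob_space_conv_power:
  assumes "prob_space M" "sets M = sets borel"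
  shows "prob_space (conv_power M n)"
  by (induction n) (auto intro!: prob_space_return prob_space_convolution assms)

text \<open>The singletons are the sections of the diagonal, so this is an instance of the
  measurability of section measures.\<close>

lemma borel_measurable_measure_singleton:
  fixes N :: "real measure"
  assumes "finite_measure N" and [measurable_cong]: "sets N = sets borel"
  shows "(\<lambda>x. measure N {x}) \<in> borel_measurable borel"
proof -
  interpret finite_measure N by fact
  have "{z. snd z = fst z} \<in> sets (borel \<Otimes>\<^sub>M N)"
  proof -
    have "{z \<in> space (borel \<Otimes>\<^sub>M N). snd z = (fst z :: real)} \<in> sets (borel \<Otimes>\<^sub>M N)"
      by measurable
    then show ?thesis by (simp add: space_pair_measure sets_eq_imp_space_eq[OF assms(2)])
  qed
  from measurable_emeasure_Pair[OF this] show ?thesis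
    by (simp add: vimage_def measure_def)
qed

text \<open>Turns convolution with \<open>M\<close> into an operator on mass functions, which can
  then be compared with the two-point average.\<close>

lemma measure_convolution_singleton:
  fixes M N :: "real measure"
  assumes "prob_space M" "prob_space N" and sets: "sets M = sets borel" "sets N = sets borel"
  shows "measure (M \<star> N) {x} = (\<integral>y. measure N {x - y} \<partial>M)"
proof -
  interpret M: prob_space M by fact
  interpret N: prob_space N by fact
  note [measurable_cong] = sets(1)
  have [measurable]: "(\<lambda>x. measure N {x}) \<in> borel_measurable borel"
    by (rule borel_measurable_measure_singleton[OF N.finite_measure_axioms sets(2)])
  have "{a. a + y \<in> {x}} = {x - y}" for y :: real
    by (auto simp: algebra_simps)
  then have "emeasure (M \<star> N) {x} = (\<integral>\<^sup>+y. measure N {x - y} \<partial>M)"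
    by (subst convolution_emeasure)
       (auto simp: sets sets_eq_imp_space_eq[OF sets(1)] sets_eq_imp_space_eq[OF sets(2)]
          N.emeasure_eq_measure intro: M.finite_measure_axioms N.finite_measure_axioms)
  also have "\<dots> = (\<integral>y. measure N {x - y} \<partial>M)"
    by (intro nn_integral_eq_integral M.integrable_const_bound[where B = 1]) auto
  finally show ?thesis
    by (simp add: measure_def integral_nonneg_AE)
qed

section \<open>The two-point averaging operator\<close>

lemma sum_binomial_Suc:
  fixes g :: "nat \<Rightarrow> real"
  shows "(\<Sum>j\<le>Suc k. real (Suc k choose j) * g j) = (\<Sum>j\<le>k. real (k choose j) * (g j + g (Suc j)))"
proof -
  have "(\<Sum>j\<le>Suc k. real (Suc k choose j) * g j)
      = g 0 + (\<Sum>j\<le>k. real (k choose Suc j) * g (Suc j)) + (\<Sum>j\<le>k. real (k choose j) * g (Suc j))"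
    by (subst sum.atMost_Suc_shift) (simp add: algebra_simps sum.distrib)
  \<comment> \<open>The added term j = \<open>Suc k\<close> vanishes, since
    \<open>k choose Suc k\<close> is 0.\<close>
  also have "g 0 + (\<Sum>j\<le>k. real (k choose Suc j) * g (Suc j)) = (\<Sum>j\<le>Suc k. real (k choose j) * g j)"
    by (subst sum.atMost_Suc_shift) simp
  finally show ?thesis
    by (simp add: algebra_simps sum.distrib)
qed

text \<open>Convolution with the uniform distribution on {a, b}, as an operator on functions so that
  \<open>^^\<close> gives its powers.\<close>

definition two_point_average :: "real \<Rightarrow> real \<Rightarrow> (real \<Rightarrow> real) \<Rightarrow> real \<Rightarrow> real" where
  "two_point_average a b f x = (f (x - a) + f (x - b)) / 2"

text \<open>Among the k shifts, j are by \<open>a\<close> and the others by \<open>b\<close>; the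
  binomial coefficient counts their orders.\<close>

lemma funpow_two_point_average:
  "(two_point_average a b ^^ k) f x
    = (\<Sum>j\<le>k. real (k choose j) * f (x - real j * a - (real k - real j) * b)) / 2 ^ k"
proof (induction k arbitrary: x)
  case 0
  show ?case by simp
next
  case (Suc k)
  let ?g = "\<lambda>j. f (x - real j * a - (real (Suc k) - real j) * b)"
  let ?h = "\<lambda>z j. f (z - real j * a - (real k - real j) * b)"
  have shift: "?h (x - a) j = ?g (Suc j)" "?h (x - b) j = ?g j" for j
    by (rule arg_cong[of _ _ f], simp add: algebra_simps)+
  have "(two_point_average a b ^^ Suc k) f x
      = ((two_point_average a b ^^ k) f (x - a) + (two_point_average a b ^^ k) f (x - b)) / 2"
    by (simp add: two_point_average_def)
  also have "\<dots> = (\<Sum>j\<le>k. real (k choose j) * (?g j + ?g (Suc j))) / 2 ^ Suc k"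
    unfolding Suc.IH shift distrib_left sum.distrib power_Suc
    by (simp only: add_divide_distrib[symmetric] divide_divide_eq_left add.commute mult.commute)
  finally show ?case
    by (simp only: sum_binomial_Suc[of k ?g])
qed

text \<open>As a \<noteq> b, the points j a + (k - j) b are distinct for distinct j. Hence at most
  one summand survives, and it is a single binomial probability.\<close>

lemma funpow_two_point_average_indicator:
  assumes "a \<noteq> b"
  shows "(two_point_average a b ^^ k) (indicator {0}) x \<le> 1 / sqrt (real k + 1)"
proof -
  let ?h = "\<lambda>j. x - real j * a - (real k - real j) * b"
  have "(\<Sum>j\<le>k. real (k choose j) * indicator {0} (?h j)) / 2 ^ k \<le> 1 / sqrt (real k + 1)"
  proof (cases "\<exists>i\<le>k. ?h i = 0")
    case True
    then obtain i where i: "i \<le> k" "?h i = 0" by blast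
    have uniq: "?h j \<noteq> 0" if "j \<noteq> i" for j
    proof -
      have "?h j = (real i - real j) * (a - b)"
        using i(2) by (simp add: algebra_simps)
      then show ?thesis using assms that by simp
    qed
    have "(\<Sum>j\<le>k. real (k choose j) * indicator {0} (?h j)) = (\<Sum>j\<in>{i}. real (k choose j))"
    proof (rule sum.mono_neutral_cong_right)
      show "\<forall>j\<in>{..k} - {i}. real (k choose j) * indicator {0} (?h j) = 0"
        using uniq by (simp add: indicator_def del: right_minus_eq diff_eq_eq)
      show "real (k choose j) * indicator {0} (?h j) = real (k choose j)" if "j \<in> {i}" for j
        using that i(2) by (simp only: singleton_iff indicator_simps)
    qed (use i(1) in auto)
    then show ?thesis
      using binomial_pow2_upper_bound[of k i] by simp
  next
    case False
    then have "(\<Sum>j\<le>k. real (k choose j) * indicator {0} (?h j)) = 0"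
      by (intro sum.neutral ballI) (simp add: indicator_def del: right_minus_eq)
    then show ?thesis by simp
  qed
  then show ?thesis by (simp add: funpow_two_point_average)
qed

lemma measurable_funpow_two_point_average:
  assumes "f \<in> borel_measurable borel"
  shows "(two_point_average a b ^^ k) f \<in> borel_measurable borel"
proof (induction k)
  case (Suc k)
  note [measurable] = Suc.IH
  have "(two_point_average a b ^^ Suc k) f = (\<lambda>x. ((two_point_average a b ^^ k) f (x - a)
      + (two_point_average a b ^^ k) f (x - b)) / 2)"
    by (simp add: fun_eq_iff two_point_average_def)
  then show ?case by simp
qed (simp add: assms)

lemma funpow_two_point_average_bounds:
  assumes "\<And>x. 0 \<le> f x" "\<And>x. f x \<le> 1"
  shows "0 \<le> (two_point_average a b ^^ k) f x \<and> (two_point_average a b ^^ k) f x \<le> 1"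
proof (induction k arbitrary: x)
  case (Suc k)
  show ?case
    using Suc.IH[of "x - a"] Suc.IH[of "x - b"] by (simp add: two_point_average_def)
qed (simp add: assms)

section \<open>Probability measures with two atoms\<close>

context real_distribution
begin

text \<open>Convolution with \<open>M\<close> commutes with averaging two translates, by linearity
  of the integral. The bounds on \<open>f\<close> make all integrands integrable.\<close>

lemma funpow_two_point_average_integral:
  fixes f :: "real \<Rightarrow> real"
  assumes [measurable]: "f \<in> borel_measurable borel" and f: "\<And>x. 0 \<le> f x" "\<And>x. f x \<le> 1"
  shows "(two_point_average a b ^^ k) (\<lambda>x. \<integral>y. f (x - y) \<partial>M) x
    = (\<integral>y. (two_point_average a b ^^ k) f (x - y) \<partial>M)"
proof (induction k arbitrary: x)
  case (Suc k)
  have [measurable]: "(two_point_average a b ^^ k) f \<in> borel_measurable borel"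
    by (rule measurable_funpow_two_point_average) measurable
  let ?g = "(two_point_average a b ^^ k) f"
  have int: "integrable M (\<lambda>y. ?g (z - y))" for z
    using funpow_two_point_average_bounds[OF f, of k a b]
    by (intro integrable_const_bound[where B = 1]) auto
  have avg: "(two_point_average a b ^^ Suc k) f (x - y) = (?g (x - a - y) + ?g (x - b - y)) / 2" for y
    by (simp add: two_point_average_def[where x = "x - y"] diff_diff_eq add.commute)
  have "(\<integral>y. (two_point_average a b ^^ Suc k) f (x - y) \<partial>M)
      = ((\<integral>y. ?g (x - a - y) \<partial>M) + (\<integral>y. ?g (x - b - y) \<partial>M)) / 2"
    unfolding avg using int by simp
  then show ?case
    by (simp add: two_point_average_def[where x = x] Suc.IH)
qed simp

text \<open>Mass \<delta> is kept at each of the two atoms, and on the remaining mass 1 - 2 \<delta>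
  the function is estimated by its bound \<open>S\<close>.\<close>

lemma integral_shift_le_two_atoms:
  fixes g :: "real \<Rightarrow> real"
  assumes [measurable]: "g \<in> borel_measurable borel"
    and g: "\<And>x. 0 \<le> g x" "\<And>x. g x \<le> S"
    and ab: "a \<noteq> b" and \<delta>: "\<delta> \<le> prob {a}" "\<delta> \<le> prob {b}"
  shows "(\<integral>y. g (x - y) \<partial>M) \<le> 2 * \<delta> * two_point_average a b g x + (1 - 2 * \<delta>) * S"
proof -
  \<comment> \<open>\<open>?r c\<close> is the saving over \<open>S\<close> at the atom c.
    Subtracting both savings from \<open>S\<close> gives a majorant that is exact at
    \<open>a\<close> and \<open>b\<close>, so the remainder of \<open>M\<close> need not be
    constructed.\<close>
  let ?r = "\<lambda>c y. (S - g (x - c)) * indicator {c} y"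
  have int: "integrable M (?r c)" for c
    by (intro integrable_mult_right integrable_real_indicator)
       (auto simp: events_eq_borel emeasure_eq_measure)
  have "(\<integral>y. g (x - y) \<partial>M) \<le> (\<integral>y. S - ?r a y - ?r b y \<partial>M)"
  proof (rule integral_mono)
    show "integrable M (\<lambda>y. g (x - y))"
      using g by (intro integrable_const_bound[where B = S]) auto
    show "integrable M (\<lambda>y. S - ?r a y - ?r b y)"
      using int by auto
    show "g (x - y) \<le> S - ?r a y - ?r b y" for y
      using ab g by (auto simp: indicator_def)
  qed
  also have "\<dots> = S - (S - g (x - a)) * prob {a} - (S - g (x - b)) * prob {b}"
    using int prob_space by simp
  also have "\<dots> \<le> S - (S - g (x - a)) * \<delta> - (S - g (x - b)) * \<delta>"
    using \<delta> g by (intro diff_mono mult_left_mono) auto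
  also have "\<dots> = 2 * \<delta> * two_point_average a b g x + (1 - 2 * \<delta>) * S"
    by (simp add: two_point_average_def algebra_simps)
  finally show ?thesis .
qed

text \<open>The power k stays arbitrary in the induction on n, because trading one factor
  \<open>M\<close> calls on the bounds for both k and \<open>Suc k\<close>. Each factor adds
  \<delta> / 2 under the root: this is d / 4 with d = 2 \<delta>.\<close>

lemma funpow_two_point_average_conv_power_le:
  assumes ab: "a \<noteq> b" and \<delta>: "0 \<le> \<delta>" "\<delta> \<le> prob {a}" "\<delta> \<le> prob {b}"
  shows "(two_point_average a b ^^ k) (\<lambda>x. measure (conv_power M n) {x}) x
    \<le> 1 / sqrt (real k + 1 + real n * (\<delta> / 2))"
proof (induction n arbitrary: k x)
  case 0
  have "(\<lambda>x. measure (conv_power M 0) {x}) = (indicator {0} :: real \<Rightarrow> real)"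
    by (auto simp: measure_return indicator_def)
  then show ?case
    using funpow_two_point_average_indicator[OF ab] by simp
next
  case (Suc n)
  let ?A = "two_point_average a b"
  let ?F = "\<lambda>n x. measure (conv_power M n) {x}"
  let ?s = "real k + 1 + real n * (\<delta> / 2)"
  interpret N: prob_space "conv_power M n"
    by (rule prob_space_conv_power[OF prob_space_axioms events_eq_borel])
  have F [measurable]: "?F n \<in> borel_measurable borel"
    by (rule borel_measurable_measure_singleton) (auto intro: N.finite_measure_axioms)
  \<comment> \<open>The atoms are disjoint, so 2 \<delta> is at most 1 and can serve as the weight
    of a convex combination.\<close>
  have "prob {a} + prob {b} \<le> 1"
    using ab finite_measure_Union[of "{a}" "{b}"] prob_le_1[of "{a, b}"]
    by (auto simp: events_eq_borel insert_commute)
  then have \<delta>1: "2 * \<delta> \<le> 1" using \<delta> by simp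
  have "?F (Suc n) = (\<lambda>x. \<integral>y. ?F n (x - y) \<partial>M)"
    using measure_convolution_singleton[OF prob_space_axioms N.prob_space_axioms events_eq_borel]
    by simp
  then have "(?A ^^ k) (?F (Suc n)) x = (\<integral>y. (?A ^^ k) (?F n) (x - y) \<partial>M)"
    using funpow_two_point_average_integral[OF F] by simp
  \<comment> \<open>The uniform bound \<open>S\<close> is the induction hypothesis for k; the other
    term contains the power \<open>Suc k\<close>, bounded next.\<close>
  also have "\<dots> \<le> 2 * \<delta> * ?A ((?A ^^ k) (?F n)) x + (1 - 2 * \<delta>) * (1 / sqrt ?s)"
    using funpow_two_point_average_bounds[of "?F n"] measurable_funpow_two_point_average[OF F]
    by (intro integral_shift_le_two_atoms Suc.IH ab \<delta>) auto
  also have "?A ((?A ^^ k) (?F n)) x \<le> 1 / sqrt (?s + 1)"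
    using Suc.IH[of "Suc k" x] by (simp add: algebra_simps)
  also have "2 * \<delta> * (1 / sqrt (?s + 1)) + (1 - 2 * \<delta>) * (1 / sqrt ?s) \<le> 1 / sqrt (?s + 2 * \<delta> / 4)"
    using \<delta> \<delta>1 by (intro inverse_sqrt_mixture_bound) auto
  also have "?s + 2 * \<delta> / 4 = real k + 1 + real (Suc n) * (\<delta> / 2)"
    by (simp add: algebra_simps)
  finally show ?case
    using \<delta> by (simp add: mult_left_mono)
qed

theorem conv_power_atom_le:
  assumes "a \<noteq> b" "0 < \<delta>" "\<delta> \<le> prob {a}" "\<delta> \<le> prob {b}" and "n \<ge> 1"
  shows "measure (conv_power M n) {x} \<le> sqrt (2 / \<delta>) / sqrt (real n)"
proof -
  have "measure (conv_power M n) {x} \<le> 1 / sqrt (1 + real n * (\<delta> / 2))"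
    using funpow_two_point_average_conv_power_le[of a b \<delta> 0 n x] assms by simp
  \<comment> \<open>Dropping the 1 under the root leaves a pure multiple of 1 / sqrt n; n \<ge> 1
    keeps the denominator positive.\<close>
  also have "\<dots> \<le> 1 / sqrt (real n * (\<delta> / 2))"
    using assms by (intro divide_left_mono mult_pos_pos) (auto simp: add_pos_pos)
  also have "\<dots> = sqrt (2 / \<delta>) / sqrt (real n)"
    using assms by (simp add: real_sqrt_mult real_sqrt_divide field_simps)
  finally show ?thesis .
qed

end

section \<open>Application to the Riemann zeta distribution\<close>

theorem theorem1p4:
  fixes \<sigma> :: real
  assumes "\<sigma> > 1"
  shows "\<exists>C>0. \<forall>n\<ge>1.
    (SUP x\<in>Lambda n. measure (conv_power (riemann_zeta_distr \<sigma>) n) {x}) \<le> C / sqrt (real n)"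
proof -
  interpret prob_space "riemann_zeta_distr \<sigma>"
    by (rule prob_space_riemann_zeta_distr[OF assms])
  interpret real_distribution "riemann_zeta_distr \<sigma>"
    by unfold_locales simp
  \<comment> \<open>The atoms are written as images of 1 and 2, the form in which
    \<open>measure_riemann_zeta_distr\<close> gives their masses.\<close>
  define \<delta> where "\<delta> = min (prob {- ln (real 1)}) (prob {- ln (real 2)})"
  have \<delta>: "0 < \<delta>" "\<delta> \<le> prob {- ln (real 1)}" "\<delta> \<le> prob {- ln (real 2)}"
    using measure_riemann_zeta_distr[OF assms, of 1] measure_riemann_zeta_distr[OF assms, of 2]
      zeta_pos[OF assms] by (auto simp: \<delta>_def)
  have "(SUP x\<in>Lambda n. measure (conv_power (riemann_zeta_distr \<sigma>) n) {x})
      \<le> sqrt (2 / \<delta>) / sqrt (real n)" if "n \<ge> 1" for n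
  proof (rule cSUP_least)
    \<comment> \<open>\<open>cSUP_least\<close> requires a nonempty index set; the tuple of ones
      supplies the point 0.\<close>
    have "replicate n 1 \<in> pos_tuples n" by (simp add: pos_tuples_def)
    then show "Lambda n \<noteq> {}" by (auto simp: Lambda_def)
  next
    show "measure (conv_power (riemann_zeta_distr \<sigma>) n) {x} \<le> sqrt (2 / \<delta>) / sqrt (real n)" for x
      using \<delta> that by (intro conv_power_atom_le[of "- ln (real 1)" "- ln (real 2)"]) auto
  qed
  then show ?thesis
    using \<delta>(1) by (intro exI[of _ "sqrt (2 / \<delta>)"]) auto
qed

end
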